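(* Let $\varphi(z)=1+B_1z+B_2z^2+B_3z^3+\cdots$ be a Ma–Minda function on $\mathbb{D}$ (so in particular $B_1>0$ and all $B_i$ are real) such that $$6B_1^2\le B_1(3B_1^2+2B_2)\le B_1^2+2B_1^4+3B_1^2B_2+3B_2^2-2B_1B_3,$$ and put $$q_1=\frac{3B_1^2+4B_2}{2B_1},\qquad q_2=\frac{B_1^3+3B_1B_2+2B_3}{2B_1}.$$ If $f\in\mathcal{S}^*(\varphi)$ and $(q_1,q_2)\in D_1\cup D_2\cup D_3$, then $$|T_{3,2}(f)|\le\left(B_1+\frac{B_1^3+3B_1B_2+2B_3}{6}\right)\left(B_1^2+\frac{B_1^4}{3}+\frac{B_1^2B_2}{2}+\frac{B_2^2}{2}-\frac{B_1B_3}{3}\right).$$ The bound is sharp: for every such $\varphi$ satisfying these conditions there is a function in $\mathcal{S}^*(\varphi)$ for which equality holds.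
   Context: $\mathbb{D}=\{z\in\mathbb{C}:|z|<1\}$. $\mathcal{S}$ is the class of univalent analytic functions $f$ on $\mathbb{D}$ of the form $f(z)=z+\sum_{n\ge2}a_nz^n$. For such $f$, $T_{3,2}(f)$ is the Toeplitz determinant $$T_{3,2}(f)=\begin{vmatrix} a_2 & a_3 & a_4 \\ a_3 & a_2 & a_3 \\ a_4 & a_3 & a_2 \end{vmatrix}.$$ A Schwarz function is an analytic $\omega:\mathbb{D}\to\mathbb{D}$ with $\omega(0)=0$. For analytic $g,h$ on $\mathbb{D}$, $g\prec h$ ($g$ is subordinate to $h$) means $g=h\circ\omega$ for some Schwarz function $\omega$. A Ma–Minda function is an analytic univalent function $\varphi$ on $\mathbb{D}$ with positive real part such that $\varphi(0)=1$, $\varphi'(0)>0$, and $\varphi(\mathbb{D})$ is symmetric with respect to the real axis and starlike with respect to $\varphi(0)=1$. Its Taylor expansion is written $\varphi(z)=1+B_1z+B_2z^2+B_3z^3+\cdots$, $B_1>0$. $\mathcal{S}^*(\varphi)=\{f\in\mathcal{S}: zf'(z)/f(z)\prec\varphi(z)\}$. The subsets $D_1,D_2,D_3$ of $\mathbb{R}^2$ are $D_1=\{(\mu,\nu):|\mu|\le2,\ \nu\ge1\}$, $D_2=\{(\mu,\nu):2\le|\mu|\le4,\ \nu\ge\frac1{12}(\mu^2+8)\}$, $D_3=\{(\mu,\nu):|\mu|\ge4,\ \nu\ge\frac23(|\mu|-1)\}$. *)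

theory Defs
  imports "HOL-Complex_Analysis.Complex_Analysis"
begin

abbreviation unit_disc :: "complex set" where
  "unit_disc \<equiv> ball 0 1"

abbreviation taylor_coeff :: "(complex \<Rightarrow> complex) \<Rightarrow> nat \<Rightarrow> complex" where
  "taylor_coeff f n \<equiv> fps_nth (fps_expansion f 0) n"

definition class_S :: "(complex \<Rightarrow> complex) set" where
  "class_S = {f. f holomorphic_on unit_disc \<and> inj_on f unit_disc \<and>
                 taylor_coeff f 0 = 0 \<and> taylor_coeff f 1 = 1}"

definition toeplitz_matrix_3_2 :: "(complex \<Rightarrow> complex) \<Rightarrow> complex^3^3" where
  "toeplitz_matrix_3_2 f = vector
     [vector [taylor_coeff f 2, taylor_coeff f 3, taylor_coeff f 4],
      vector [taylor_coeff f 3, taylor_coeff f 2, taylor_coeff f 3],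
      vector [taylor_coeff f 4, taylor_coeff f 3, taylor_coeff f 2]]"

definition T32 :: "(complex \<Rightarrow> complex) \<Rightarrow> complex" where
  "T32 f = det (toeplitz_matrix_3_2 f)"

definition schwarz_function :: "(complex \<Rightarrow> complex) \<Rightarrow> bool" where
  "schwarz_function \<omega> \<longleftrightarrow>
     \<omega> holomorphic_on unit_disc \<and> \<omega> ` unit_disc \<subseteq> unit_disc \<and> \<omega> 0 = 0"

definition subordinate :: "(complex \<Rightarrow> complex) \<Rightarrow> (complex \<Rightarrow> complex) \<Rightarrow> bool" where
  "subordinate g h \<longleftrightarrow>
     g holomorphic_on unit_disc \<and> h holomorphic_on unit_disc \<and>
     (\<exists>\<omega>. schwarz_function \<omega> \<and> (\<forall>z\<in>unit_disc. g z = h (\<omega> z)))"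

definition ma_minda :: "(complex \<Rightarrow> complex) \<Rightarrow> bool" where
  "ma_minda \<phi> \<longleftrightarrow>
     \<phi> holomorphic_on unit_disc \<and> inj_on \<phi> unit_disc \<and>
     (\<forall>z\<in>unit_disc. Re (\<phi> z) > 0) \<and>
     \<phi> 0 = 1 \<and> deriv \<phi> 0 \<in> \<real> \<and> Re (deriv \<phi> 0) > 0 \<and>
     cnj ` (\<phi> ` unit_disc) = \<phi> ` unit_disc \<and>
     (\<forall>w\<in>\<phi> ` unit_disc. closed_segment 1 w \<subseteq> \<phi> ` unit_disc)"

text \<open>
  For \<open>f\<close> in class S the quotient \<open>z f'(z) / f(z)\<close> has a removable singularity at the origin
  with limit 1, whereas division by zero in HOL would give it the value 0 there.
\<close>

definition starlike_quotient :: "(complex \<Rightarrow> complex) \<Rightarrow> complex \<Rightarrow> complex" where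
  "starlike_quotient f z = (if z = 0 then 1 else z * deriv f z / f z)"

definition S_star :: "(complex \<Rightarrow> complex) \<Rightarrow> (complex \<Rightarrow> complex) set" where
  "S_star \<phi> = {f \<in> class_S. subordinate (starlike_quotient f) \<phi>}"

definition D1 :: "(real \<times> real) set" where
  "D1 = {(\<mu>, \<nu>). \<bar>\<mu>\<bar> \<le> 2 \<and> \<nu> \<ge> 1}"

definition D2 :: "(real \<times> real) set" where
  "D2 = {(\<mu>, \<nu>). 2 \<le> \<bar>\<mu>\<bar> \<and> \<bar>\<mu>\<bar> \<le> 4 \<and> \<nu> \<ge> (1/12) * (\<mu>^2 + 8)}"

definition D3 :: "(real \<times> real) set" where
  "D3 = {(\<mu>, \<nu>). \<bar>\<mu>\<bar> \<ge> 4 \<and> \<nu> \<ge> (2/3) * (\<bar>\<mu>\<bar> - 1)}"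

text \<open>
  The Taylor coefficients of a Ma-Minda function are real, so nothing is lost by passing to
  their real parts: by uniqueness of the normalised Riemann map onto the symmetric image,
  \<open>\<phi> (cnj z) = cnj (\<phi> z)\<close>.
\<close>

lemma ma_minda_cnj:
  assumes "ma_minda \<phi>" and z: "z \<in> unit_disc"
  shows "\<phi> (cnj z) = cnj (\<phi> z)"
proof -
  have hol: "\<phi> holomorphic_on unit_disc" and inj: "inj_on \<phi> unit_disc"
    and \<phi>0: "\<phi> 0 = 1" and dr: "deriv \<phi> 0 \<in> \<real>" and dp: "Re (deriv \<phi> 0) > 0"
    and sym: "cnj ` (\<phi> ` unit_disc) = \<phi> ` unit_disc"
    using assms(1) by (auto simp: ma_minda_def)
  define \<psi> where "\<psi> = cnj \<circ> \<phi> \<circ> cnj"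
  obtain g where g: "g holomorphic_on (\<phi> ` unit_disc)" "\<And>z. z \<in> unit_disc \<Longrightarrow> g (\<phi> z) = z"
    using holomorphic_has_inverse[OF hol _ inj] by (metis open_ball)
  have d\<phi>: "(\<phi> has_field_derivative deriv \<phi> z) (at z)" if "z \<in> unit_disc" for z
    using hol that by (intro holomorphic_derivI[of _ unit_disc]) auto
  have d\<psi>: "(\<psi> has_field_derivative cnj (deriv \<phi> (cnj z))) (at z)" if "z \<in> unit_disc" for z
    using d\<phi>[of "cnj z"] that unfolding \<psi>_def by (subst has_field_derivative_cnj_cnj) (auto simp: dist_norm)
  have \<psi>hol: "\<psi> holomorphic_on unit_disc"
    using d\<psi> by (meson holomorphic_on_open open_ball)
  have im: "\<psi> z \<in> \<phi> ` unit_disc" if "z \<in> unit_disc" for z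
  proof -
    have "cnj z \<in> unit_disc" using that by (simp add: dist_norm)
    then show ?thesis using sym unfolding \<psi>_def by (metis comp_apply image_eqI)
  qed
  define h where "h = g \<circ> \<psi>"
  have hhol: "h holomorphic_on unit_disc"
    unfolding h_def using im by (intro holomorphic_on_compose_gen[OF \<psi>hol g(1)]) auto
  have hin: "h z \<in> unit_disc" and \<phi>h: "\<phi> (h z) = \<psi> z" if "z \<in> unit_disc" for z
    using im[OF that] g(2) by (auto simp: h_def)
  have h0: "h 0 = 0" using g(2)[of 0] by (simp add: h_def \<psi>_def \<phi>0)
  have dh: "(h has_field_derivative deriv h 0) (at 0)"
    using hhol by (intro holomorphic_derivI[of _ unit_disc]) auto
  have "(\<phi> \<circ> h has_field_derivative deriv \<phi> 0 * deriv h 0) (at 0)"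
    using d\<phi>[of 0] dh h0 by (intro DERIV_chain) auto
  moreover have "(\<phi> \<circ> h has_field_derivative deriv \<phi> 0) (at 0)"
  proof -
    have "(\<psi> has_field_derivative deriv \<phi> 0) (at 0)" using d\<psi>[of 0] dr
      by (simp add: Reals_cnj_iff)
    then show ?thesis
      by (rule has_field_derivative_transform_within_open[of _ _ _ unit_disc]) (use \<phi>h in auto)
  qed
  ultimately have "deriv \<phi> 0 * deriv h 0 = deriv \<phi> 0" by (rule DERIV_unique)
  then have dh1: "deriv h 0 = 1" using dp by auto
  have "\<And>z. norm z < 1 \<Longrightarrow> norm (h z) < 1" using hin by (auto simp: dist_norm)
  then obtain \<alpha> where \<alpha>: "\<And>z. norm z < 1 \<Longrightarrow> h z = \<alpha> * z"
    using Schwarz_Lemma(3)[OF hhol h0, of 0] dh1 by auto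
  have "(h has_field_derivative \<alpha>) (at 0)"
  proof -
    have "((\<lambda>z. \<alpha> * z) has_field_derivative \<alpha>) (at 0)" by (auto intro!: derivative_eq_intros)
    then show ?thesis
      by (rule has_field_derivative_transform_within_open[of _ _ _ unit_disc]) (use \<alpha> in auto)
  qed
  with dh dh1 have "\<alpha> = 1" by (metis DERIV_unique)
  then have "\<phi> z = \<psi> z" using \<phi>h[OF z] \<alpha>[of z] z by auto
  then show ?thesis by (simp add: \<psi>_def)
qed

lemma ma_minda_coeff_real:
  assumes "ma_minda \<phi>"
  shows "complex_of_real (Re (taylor_coeff \<phi> n)) = taylor_coeff \<phi> n"
proof -
  have hol: "\<phi> holomorphic_on unit_disc" using assms by (auto simp: ma_minda_def)
  have s: "(\<lambda>n. taylor_coeff \<phi> n * z ^ n) sums \<phi> z" if "z \<in> unit_disc" for z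
    using holomorphic_power_series[OF hol that] by (simp add: fps_expansion_def)
  define G where "G = Abs_fps (\<lambda>n. cnj (taylor_coeff \<phi> n))"
  have "(\<lambda>n. fps_nth G n * z ^ n) sums \<phi> z" if z: "z \<in> unit_disc" for z
  proof -
    have "cnj z \<in> unit_disc" using z by (simp add: dist_norm)
    from s[OF this] have "(\<lambda>n. cnj (taylor_coeff \<phi> n * cnj z ^ n)) sums cnj (\<phi> (cnj z))"
      by (simp only: sums_cnj)
    then show ?thesis using ma_minda_cnj[OF assms z] by (simp add: G_def)
  qed
  then have "\<phi> has_fps_expansion G"
    by (intro has_fps_expansionI eventually_nhds_in_open[of unit_disc, THEN eventually_mono]) auto
  moreover have "\<phi> has_fps_expansion fps_expansion \<phi> 0"
    using s by (intro has_fps_expansionI eventually_nhds_in_open[of unit_disc, THEN eventually_mono]) auto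
  ultimately have "fps_expansion \<phi> 0 = G" by (metis fps_expansion_unique_complex)
  then have "taylor_coeff \<phi> n = cnj (taylor_coeff \<phi> n)" by (metis G_def fps_nth_Abs_fps)
  then show ?thesis by (metis Reals_cnj_iff of_real_Re)
qed

end

(* The determinant factors as (a2 - a4) (a2^2 + a2 a4 - 2 a3^2). Writing z f'/f = phi o omega, the
   coefficients of f are polynomials in those of omega, which the Schur algorithm parametrises as
   c, (1 - |c|^2) g, (1 - |c|^2) ((1 - |g|^2) h - cnj c g^2). In particular
   a4 = B1/3 (c3 + q1 c1 c2 + q2 c1^3), and the hypothesis on (q1, q2) puts us where the
   Prokhorov-Szynal functional is bounded by q2. The second factor needs only |c2|, |c3| <= 1 - |c1|^2.
   Equality holds for omega z = i z; the corresponding f = z exp(...) is univalent because a pair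
   z, w with f z = f w of minimal max(|z|, |w|) could be shrunk by moving both points along the
   preimages of the segment from f z to 0, which point inwards since Re (z f'/f) > 0. *)

theory Submission
  imports Defs
begin

section \<open>Schur parameters of a Schwarz function\<close>

text \<open>If |h| attains 1, the maximum modulus principle makes \<open>h\<close> constant and
  \<open>k = 0\<close> works. Otherwise \<open>h\<close> followed by the disc automorphism taking
  \<open>h 0\<close> to 0 satisfies the Schwarz lemma, and \<open>k\<close> is its quotient by
  \<open>z\<close>. The denominator is multiplied out because it vanishes for a unimodular
  constant.\<close>

lemma schur_step:
  assumes hol: "h holomorphic_on unit_disc" and bd: "\<And>z. z \<in> unit_disc \<Longrightarrow> cmod (h z) \<le> 1"
  obtains k where "k holomorphic_on unit_disc" "\<And>z. z \<in> unit_disc \<Longrightarrow> cmod (k z) \<le> 1"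
    "\<And>z. z \<in> unit_disc \<Longrightarrow> h z - h 0 = z * k z * (1 - cnj (h 0) * h z)"
proof (cases "\<exists>w\<in>unit_disc. cmod (h w) = 1")
  case True
  then obtain w where w: "w \<in> unit_disc" "cmod (h w) = 1" by blast
  have "h constant_on unit_disc"
    using maximum_modulus_principle[OF hol, of unit_disc w] w bd by auto
  then obtain d where "\<And>z. z \<in> unit_disc \<Longrightarrow> h z = d"
    unfolding constant_on_def by blast
  then show ?thesis by (auto intro!: that[of "\<lambda>_. 0"])
next
  case False
  then have lt: "cmod (h z) < 1" if "z \<in> unit_disc" for z
    using bd that by (metis order_le_less)
  define c where "c = h 0"
  have c: "cmod c < 1" using lt[of 0] by (simp add: c_def)
  have nz: "1 - cnj c * h z \<noteq> 0" if "z \<in> unit_disc" for z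
  proof
    assume "1 - cnj c * h z = 0"
    then have "cmod c * cmod (h z) = 1" by (metis complex_mod_cnj eq_iff_diff_eq_0 norm_mult norm_one)
    moreover have "cmod c * cmod (h z) \<le> cmod c * 1" using lt[OF that] by (intro mult_left_mono) auto
    ultimately show False using c by simp
  qed
  define M where "M z = (h z - c) / (1 - cnj c * h z)" for z
  have Mhol: "M holomorphic_on unit_disc"
    unfolding M_def using nz hol by (intro holomorphic_intros) auto
  have M0: "M 0 = 0" by (simp add: M_def c_def)
  have Mlt: "cmod (M z) < 1" if "cmod z < 1" for z
  proof -
    have z: "z \<in> unit_disc" using that by simp
    \<comment> \<open>The squared denominator of \<open>M\<close> exceeds the squared numerator by a
      product of two positive factors, so \<open>M\<close> maps into the disc.\<close>
    have id: "(cmod (1 - cnj c * w))\<^sup>2 - (cmod (w - c))\<^sup>2 = (1 - (cmod c)\<^sup>2) * (1 - (cmod w)\<^sup>2)" for w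
      unfolding cmod_power2 by (simp add: power2_eq_square algebra_simps)
    have "(1 - (cmod c)\<^sup>2) * (1 - (cmod (h z))\<^sup>2) > 0"
      using c lt[OF z] by (intro mult_pos_pos) (auto simp: abs_square_less_1)
    then have "(cmod (h z - c))\<^sup>2 < (cmod (1 - cnj c * h z))\<^sup>2" using id[of "h z"] by simp
    then have "cmod (h z - c) < cmod (1 - cnj c * h z)" by (rule power2_less_imp_less) simp
    then show ?thesis using nz[OF z] by (simp add: M_def norm_divide)
  qed
  obtain k where k: "k holomorphic_on unit_disc" "\<And>z. cmod z < 1 \<Longrightarrow> M z = z * k z" "deriv M 0 = k 0"
    using Schwarz3[OF Mhol M0] by blast
  \<comment> \<open>Away from the origin this is |M z| \<le> |z|; at the origin it is the derivative
    bound of the Schwarz lemma, as \<open>k 0\<close> equals \<open>deriv M 0\<close>.\<close>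
  have "cmod (k z) \<le> 1" if "z \<in> unit_disc" for z
  proof (cases "z = 0")
    case True
    then show ?thesis using Schwarz_Lemma(2)[OF Mhol M0 Mlt, of 0] k(3) by simp
  next
    case False
    then show ?thesis using Schwarz_Lemma(1)[OF Mhol M0 Mlt, of z] k(2)[of z] that
      by (auto simp: norm_mult)
  qed
  moreover have "h z - c = z * k z * (1 - cnj c * h z)" if "z \<in> unit_disc" for z
    using k(2)[of z] nz[OF that] that by (auto simp: M_def field_simps)
  ultimately show ?thesis using that[of k] k(1) by (auto simp: c_def)
qed

lemma has_fps_expansion_unit_disc:
  "f holomorphic_on unit_disc \<Longrightarrow> f has_fps_expansion fps_expansion f 0"
  by (rule has_fps_expansion_fps_expansion[of unit_disc]) auto

lemma has_fps_expansion_unit_disc_cong: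
  assumes "f has_fps_expansion F" "g has_fps_expansion G" "\<And>z. z \<in> unit_disc \<Longrightarrow> f z = g z"
  shows "F = G"
proof -
  have "eventually (\<lambda>z. f z = g z) (nhds 0)"
    using assms(3) by (intro eventually_nhds_in_open[of unit_disc, THEN eventually_mono]) auto
  then have "g has_fps_expansion F" using assms(1) has_fps_expansion_cong by blast
  then show ?thesis using assms(2) fps_expansion_unique_complex by blast
qed

lemma taylor_coeff_0: "taylor_coeff f 0 = f 0"
  by (simp add: fps_expansion_def)

lemma schur_step_coeffs:
  assumes hol: "h holomorphic_on unit_disc" and bd: "\<And>z. z \<in> unit_disc \<Longrightarrow> cmod (h z) \<le> 1"
  obtains k where "k holomorphic_on unit_disc" "\<And>z. z \<in> unit_disc \<Longrightarrow> cmod (k z) \<le> 1"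
    "fps_expansion h 0 - fps_const (h 0)
       = fps_X * fps_expansion k 0 * (1 - fps_const (cnj (h 0)) * fps_expansion h 0)"
proof -
  obtain k where k: "k holomorphic_on unit_disc" "\<And>z. z \<in> unit_disc \<Longrightarrow> cmod (k z) \<le> 1"
    "\<And>z. z \<in> unit_disc \<Longrightarrow> h z - h 0 = z * k z * (1 - cnj (h 0) * h z)"
    using schur_step[OF hol bd] by blast
  have "fps_expansion h 0 - fps_const (h 0)
       = fps_X * fps_expansion k 0 * (1 - fps_const (cnj (h 0)) * fps_expansion h 0)"
  proof (rule has_fps_expansion_unit_disc_cong[OF _ _ k(3)])
    show "(\<lambda>z. h z - h 0) has_fps_expansion fps_expansion h 0 - fps_const (h 0)"
      "(\<lambda>z. z * k z * (1 - cnj (h 0) * h z)) has_fps_expansion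
        fps_X * fps_expansion k 0 * (1 - fps_const (cnj (h 0)) * fps_expansion h 0)"
      by (intro fps_expansion_intros has_fps_expansion_unit_disc hol k(1))+
  qed
  with k show ?thesis using that by blast
qed

text \<open>Three Schur steps lead from \<open>\<omega>\<close> to \<open>g\<close>,
  \<open>k\<close> and \<open>l\<close>, the first being plain division by \<open>z\<close> since
  \<open>\<omega> 0 = 0\<close>. The parameters are the values of \<open>g\<close>, \<open>k\<close>
  and \<open>l\<close> at 0, and comparing low-order coefficients of the three identities expresses
  the coefficients of \<open>\<omega>\<close> through them.\<close>

lemma schwarz_coeffs:
  assumes "schwarz_function \<omega>"
  obtains c \<gamma> \<eta> where "cmod c \<le> 1" "cmod \<gamma> \<le> 1" "cmod \<eta> \<le> 1" "taylor_coeff \<omega> 1 = c"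
    "taylor_coeff \<omega> 2 = of_real (1 - (cmod c)\<^sup>2) * \<gamma>"
    "taylor_coeff \<omega> 3 = of_real (1 - (cmod c)\<^sup>2) * (of_real (1 - (cmod \<gamma>)\<^sup>2) * \<eta> - cnj c * \<gamma>\<^sup>2)"
proof -
  have hol: "\<omega> holomorphic_on unit_disc" and bd: "\<And>z. z \<in> unit_disc \<Longrightarrow> cmod (\<omega> z) \<le> 1"
    and \<omega>0: "\<omega> 0 = 0"
    using assms by (force simp: schwarz_function_def)+
  obtain g where g: "g holomorphic_on unit_disc" "\<And>z. z \<in> unit_disc \<Longrightarrow> cmod (g z) \<le> 1"
    "fps_expansion \<omega> 0 = fps_X * fps_expansion g 0"
    using schur_step_coeffs[OF hol bd] \<omega>0 by auto
  obtain k where k: "k holomorphic_on unit_disc" "\<And>z. z \<in> unit_disc \<Longrightarrow> cmod (k z) \<le> 1"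
    "fps_expansion g 0 - fps_const (g 0)
       = fps_X * fps_expansion k 0 * (1 - fps_const (cnj (g 0)) * fps_expansion g 0)"
    using schur_step_coeffs[OF g(1,2)] by blast
  obtain l where l: "l holomorphic_on unit_disc" "\<And>z. z \<in> unit_disc \<Longrightarrow> cmod (l z) \<le> 1"
    "fps_expansion k 0 - fps_const (k 0)
       = fps_X * fps_expansion l 0 * (1 - fps_const (cnj (k 0)) * fps_expansion k 0)"
    using schur_step_coeffs[OF k(1,2)] by blast
  have sq: "cnj z * z = of_real ((cmod z)\<^sup>2)" for z
    by (metis complex_norm_square mult.commute of_real_power)
  have g1: "taylor_coeff g 1 = k 0 * (1 - of_real ((cmod (g 0))\<^sup>2))"
    using arg_cong[OF k(3), of "\<lambda>F. fps_nth F 1"]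
    by (simp add: mult.assoc fps_mult_fps_X_commute taylor_coeff_0 sq)
  have k1: "taylor_coeff k 1 = l 0 * (1 - of_real ((cmod (k 0))\<^sup>2))"
    using arg_cong[OF l(3), of "\<lambda>F. fps_nth F 1"]
    by (simp add: mult.assoc fps_mult_fps_X_commute taylor_coeff_0 sq)
  have g2: "taylor_coeff g 2 = taylor_coeff k 1 * (1 - of_real ((cmod (g 0))\<^sup>2)) - k 0 * cnj (g 0) * taylor_coeff g 1"
    using arg_cong[OF k(3), of "\<lambda>F. fps_nth F 2"]
    by (simp add: mult.assoc fps_mult_nth_1 taylor_coeff_0 sq)
  show ?thesis
  proof (rule that[of "g 0" "k 0" "l 0"])
    show "taylor_coeff \<omega> 1 = g 0"
      by (simp add: g(3) taylor_coeff_0)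
    show "taylor_coeff \<omega> 2 = of_real (1 - (cmod (g 0))\<^sup>2) * k 0"
      using g1 by (simp add: g(3) algebra_simps)
    show "taylor_coeff \<omega> 3 = of_real (1 - (cmod (g 0))\<^sup>2) * (of_real (1 - (cmod (k 0))\<^sup>2) * l 0 - cnj (g 0) * (k 0)\<^sup>2)"
      unfolding g(3) using g2 unfolding g1 k1 by (simp add: algebra_simps power2_eq_square)
  qed (use g k l in auto)
qed

section \<open>The Prokhorov-Szynal inequality\<close>

text \<open>
  Cleared of denominators the first claim reads \<open>(\<nu> - d)\<^sup>2 (\<nu> + 2 d) \<le> \<nu>\<^sup>3\<close> with \<open>d = (\<nu> - 1) v\<close>;
  the parabola \<open>\<mu>\<^sup>2 \<le> 12 \<nu> - 8\<close> is exactly where the term linear in \<open>d\<close> vanishes.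
\<close>

lemma weighted_radius_bound:
  fixes u v \<mu> \<nu> R :: real
  assumes uv: "0 \<le> u" "0 \<le> v" "u + v = 1" and \<nu>: "\<nu> \<ge> 1" and \<mu>: "\<mu>\<^sup>2 \<le> 12 * \<nu> - 8"
    and R: "0 \<le> R" "R\<^sup>2 = u + \<mu>\<^sup>2 / (4 * \<nu>) * v"
  shows "(\<nu> * u + v) * R \<le> \<nu>" "\<nu> * u * R + v \<le> \<nu>"
proof -
  define d where "d = (\<nu> - 1) * v"
  have d: "0 \<le> d" "d \<le> \<nu>" and nd: "\<nu> * u + v = \<nu> - d"
  proof -
    show "0 \<le> d" using uv \<nu> by (simp add: d_def)
    have u: "u = 1 - v" using uv by simp
    show eq: "\<nu> * u + v = \<nu> - d" by (simp add: d_def u algebra_simps)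
    show "d \<le> \<nu>" using eq uv \<nu> by (smt (verit) mult_nonneg_nonneg)
  qed
  have "\<nu> * R\<^sup>2 = \<nu> * u + \<mu>\<^sup>2 * v / 4" using R \<nu> by (simp add: field_simps)
  also have "\<dots> \<le> \<nu> * u + (12 * \<nu> - 8) * v / 4" using \<mu> uv by (simp add: mult_right_mono)
  also have "\<dots> = \<nu> + 2 * d" using nd by (simp add: d_def field_simps)
  finally have R2: "\<nu> * R\<^sup>2 \<le> \<nu> + 2 * d" .
  have "\<nu> * ((\<nu> - d) * R)\<^sup>2 = (\<nu> - d)\<^sup>2 * (\<nu> * R\<^sup>2)" by (simp add: power_mult_distrib)
  also have "\<dots> \<le> (\<nu> - d)\<^sup>2 * (\<nu> + 2 * d)" using R2 by (intro mult_left_mono) auto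
  also have "\<dots> = \<nu> * \<nu>\<^sup>2 - d\<^sup>2 * (3 * \<nu> - 2 * d)" by (simp add: power2_eq_square algebra_simps)
  also have "\<dots> \<le> \<nu> * \<nu>\<^sup>2" using d \<nu> by simp
  finally have "((\<nu> - d) * R)\<^sup>2 \<le> \<nu>\<^sup>2" using \<nu> by simp
  then show 1: "(\<nu> * u + v) * R \<le> \<nu>" using power2_le_imp_le[of "(\<nu> - d) * R" \<nu>] \<nu> nd by simp
  \<comment> \<open>The second claim follows from the first: after multiplication by the positive
    \<open>\<nu> * u + v\<close>, the slack is \<open>(\<nu> - 1) * v\<^sup>2\<close>.\<close>
  have pos: "\<nu> * u + v > 0" using uv \<nu> by (smt (verit) mult_le_cancel_right1 mult_nonneg_nonneg)
  have "(\<nu> * u + v) * (\<nu> * u * R) \<le> \<nu> * u * \<nu>"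
    using mult_left_mono[OF 1, of "\<nu> * u"] uv \<nu> by (simp add: algebra_simps)
  also have "\<dots> = (\<nu> * u + v) * (\<nu> - v) - (\<nu> - 1) * v\<^sup>2"
  proof -
    have "u = 1 - v" using uv(3) by simp
    then show ?thesis by (simp only:) (simp add: power2_eq_square algebra_simps)
  qed
  also have "\<dots> \<le> (\<nu> * u + v) * (\<nu> - v)" using \<nu> by simp
  finally show "\<nu> * u * R + v \<le> \<nu>" using pos by (simp add: mult_le_cancel_left)
qed

text \<open>This is the case of real \<open>c = x\<close>, with the term in \<eta> replaced by its
  largest modulus. For fixed \<open>s\<close>, the squared modulus of \<open>\<gamma>\<close>,
  maximising over the argument of \<open>\<gamma>\<close> leaves a bound affine in \<open>s\<close>,
  so the endpoints \<open>s = 1\<close> and \<open>s = 0\<close> suffice; they are the two claims of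
  \<open>weighted_radius_bound\<close>.\<close>

lemma prokhorov_szynal_parabola_aux:
  fixes x \<mu> \<nu> :: real and \<gamma> :: complex
  assumes x: "0 \<le> x" "x \<le> 1" and \<nu>: "\<nu> \<ge> 1" and \<mu>: "\<mu>\<^sup>2 \<le> 12 * \<nu> - 8" and \<gamma>: "cmod \<gamma> \<le> 1"
  shows "x * cmod (of_real (\<nu> * x\<^sup>2) + of_real (1 - x\<^sup>2) * (of_real \<mu> * \<gamma> - \<gamma>\<^sup>2))
           + (1 - x\<^sup>2) * (1 - (cmod \<gamma>)\<^sup>2) \<le> \<nu>"
proof -
  define u v s where "u = x\<^sup>2" and "v = 1 - x\<^sup>2" and "s = (cmod \<gamma>)\<^sup>2"
  define N where "N = cmod (of_real (\<nu> * u) + of_real v * (of_real \<mu> * \<gamma> - \<gamma>\<^sup>2))"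
  define R where "R = sqrt (u + \<mu>\<^sup>2 / (4 * \<nu>) * v)"
  have uv: "0 \<le> u" "0 \<le> v" "u + v = 1" and s: "0 \<le> s" "s \<le> 1"
    using x \<gamma> by (auto simp: u_def v_def s_def power_le_one)
  have R: "0 \<le> R" "R\<^sup>2 = u + \<mu>\<^sup>2 / (4 * \<nu>) * v"
    unfolding R_def using uv \<nu> by simp_all
  obtain a b where ab: "\<gamma> = Complex a b" by (cases \<gamma>)
  have sab: "s = a\<^sup>2 + b\<^sup>2" by (simp add: s_def ab cmod_power2)
  have "N\<^sup>2 = (\<nu> * u + v * (\<mu> * a - (a\<^sup>2 - b\<^sup>2)))\<^sup>2 + (v * (\<mu> * b - 2 * a * b))\<^sup>2"
    unfolding N_def cmod_power2 ab by (simp add: power2_eq_square algebra_simps)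
  then have "4 * \<nu> * u * N\<^sup>2 + v * (4 * \<nu> * u * a - \<mu> * (\<nu> * u - v * s))\<^sup>2
      = (\<nu> * u + v * s)\<^sup>2 * (4 * \<nu> * u + \<mu>\<^sup>2 * v)"
    unfolding sab by algebra
  \<comment> \<open>completing the square in \<open>Re \<gamma>\<close> for fixed \<open>cmod \<gamma>\<close>\<close>
  moreover have "0 \<le> v * (4 * \<nu> * u * a - \<mu> * (\<nu> * u - v * s))\<^sup>2" using uv by simp
  ultimately have "4 * \<nu> * u * N\<^sup>2 \<le> (\<nu> * u + v * s)\<^sup>2 * (4 * \<nu> * u + \<mu>\<^sup>2 * v)" by linarith
  also have "4 * \<nu> * u + \<mu>\<^sup>2 * v = 4 * \<nu> * R\<^sup>2" using R \<nu> by (simp add: field_simps)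
  finally have "4 * \<nu> * (x * N)\<^sup>2 \<le> 4 * \<nu> * ((\<nu> * u + v * s) * R)\<^sup>2"
    by (simp add: u_def power_mult_distrib mult_ac)
  then have "(x * N)\<^sup>2 \<le> ((\<nu> * u + v * s) * R)\<^sup>2" using \<nu> by simp
  then have xN: "x * N \<le> (\<nu> * u + v * s) * R"
    by (rule power2_le_imp_le) (use uv s \<nu> R in auto)
  have "x * N + v * (1 - s) \<le> s * ((\<nu> * u + v) * R) + (1 - s) * (\<nu> * u * R + v)"
    using xN by (simp add: algebra_simps)
  also have "\<dots> \<le> s * \<nu> + (1 - s) * \<nu>"
    using weighted_radius_bound[OF uv \<nu> \<mu> R] s by (intro add_mono mult_left_mono) auto
  finally show ?thesis by (simp add: N_def u_def v_def s_def algebra_simps)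
qed

text \<open>The functional is homogeneous under rotations: writing \<open>c = x * e\<close> and
  \<open>\<gamma> = \<delta> * e\<^sup>2\<close> with |e| = 1 pulls a common factor
  \<open>e ^ 3\<close> out of all terms free of \<eta>. The triangle inequality then splits off the
  \<eta> term and leaves the case of real \<open>c\<close>.\<close>

lemma prokhorov_szynal_parabola:
  fixes \<mu> \<nu> :: real and c \<gamma> \<eta> :: complex
  assumes c: "cmod c \<le> 1" and \<gamma>: "cmod \<gamma> \<le> 1" and \<eta>: "cmod \<eta> \<le> 1"
    and \<nu>: "\<nu> \<ge> 1" and \<mu>: "\<mu>\<^sup>2 \<le> 12 * \<nu> - 8"
    and c2: "c2 = of_real (1 - (cmod c)\<^sup>2) * \<gamma>"
    and c3: "c3 = of_real (1 - (cmod c)\<^sup>2) * (of_real (1 - (cmod \<gamma>)\<^sup>2) * \<eta> - cnj c * \<gamma>\<^sup>2)"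
  shows "cmod (c3 + of_real \<mu> * c * c2 + of_real \<nu> * c ^ 3) \<le> \<nu>"
proof -
  \<comment> \<open>Taking \<open>cis (Arg c)\<close> keeps \<open>e\<close> unimodular even when
    \<open>c = 0\<close>.\<close>
  define x e where "x = cmod c" and "e = cis (Arg c)"
  have ce: "c = of_real x * e" unfolding x_def e_def by (metis rcis_cmod_Arg rcis_def)
  have e: "cmod e = 1" "cnj e * e = 1" "e \<noteq> 0"
    by (auto simp: e_def cis_cnj cis_mult)
  define v where "v = 1 - x\<^sup>2"
  define \<delta> where "\<delta> = \<gamma> * (cnj e)\<^sup>2"
  have \<gamma>\<delta>: "\<gamma> = \<delta> * e\<^sup>2" unfolding \<delta>_def using e(2) by algebra
  have n\<delta>: "cmod \<delta> = cmod \<gamma>" by (simp add: \<delta>_def norm_mult norm_power e)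
  have cnjc: "cnj c = of_real x * cnj e" by (simp add: ce)
  have "c3 + of_real \<mu> * c * c2 + of_real \<nu> * c ^ 3
      = of_real v * of_real (1 - (cmod \<gamma>)\<^sup>2) * \<eta>
        + e ^ 3 * of_real x * (of_real (\<nu> * x\<^sup>2) + of_real v * (of_real \<mu> * \<delta> - \<delta>\<^sup>2))"
    unfolding c2 c3 cnjc x_def[symmetric] v_def[symmetric]
    unfolding ce \<gamma>\<delta> of_real_mult of_real_power using e(2) by algebra
  also have "cmod \<dots> \<le> v * (1 - (cmod \<gamma>)\<^sup>2)
        + x * cmod (of_real (\<nu> * x\<^sup>2) + of_real v * (of_real \<mu> * \<delta> - \<delta>\<^sup>2))"
  proof (rule order_trans[OF norm_triangle_ineq add_mono])
    have "v * (1 - (cmod \<gamma>)\<^sup>2) \<ge> 0" using c \<gamma> by (simp add: v_def x_def power_le_one)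
    then show "cmod (of_real v * of_real (1 - (cmod \<gamma>)\<^sup>2) * \<eta>) \<le> v * (1 - (cmod \<gamma>)\<^sup>2)"
      using mult_left_mono[OF \<eta>, of "v * (1 - (cmod \<gamma>)\<^sup>2)"]
      by (simp only: norm_mult norm_of_real abs_mult[symmetric] of_real_mult[symmetric]) simp
  qed (simp add: norm_mult norm_power e x_def)
  also have "\<dots> \<le> \<nu>"
    using prokhorov_szynal_parabola_aux[of x \<nu> \<mu> \<delta>] c \<nu> \<mu> \<gamma> by (simp add: x_def v_def n\<delta>)
  finally show ?thesis .
qed

text \<open>
  The part of \<open>D3\<close> below the parabola lies above the two tangent rays from \<open>(\<plusminus>4, 2)\<close> with slope
  \<open>\<plusminus>2/3\<close>; the estimate is linear in \<open>(\<mu>, \<nu>)\<close>, so it suffices to check the directions of these rays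
  and the vertical direction.
\<close>

lemma prokhorov_szynal:
  fixes \<mu> \<nu> :: real and c \<gamma> \<eta> :: complex
  assumes c: "cmod c \<le> 1" and \<gamma>: "cmod \<gamma> \<le> 1" and \<eta>: "cmod \<eta> \<le> 1"
    and D: "(\<mu>, \<nu>) \<in> D1 \<union> D2 \<union> D3"
    and c2: "c2 = of_real (1 - (cmod c)\<^sup>2) * \<gamma>"
    and c3: "c3 = of_real (1 - (cmod c)\<^sup>2) * (of_real (1 - (cmod \<gamma>)\<^sup>2) * \<eta> - cnj c * \<gamma>\<^sup>2)"
  shows "cmod (c3 + of_real \<mu> * c * c2 + of_real \<nu> * c ^ 3) \<le> \<nu>"
proof (cases "\<mu>\<^sup>2 \<le> 12 * \<nu> - 8 \<and> \<nu> \<ge> 1")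
  case True
  then show ?thesis using prokhorov_szynal_parabola[OF c \<gamma> \<eta> _ _ c2 c3] by blast
next
  case False
  \<comment> \<open>\<open>D1\<close> and \<open>D2\<close> lie on or above the parabola with
    \<open>\<nu> \<ge> 1\<close>, which is the case already settled; what remains is in
    \<open>D3\<close>.\<close>
  have "\<bar>\<mu>\<bar> \<ge> 4 \<and> \<nu> \<ge> (2/3) * (\<bar>\<mu>\<bar> - 1)"
  proof (rule ccontr)
    assume neg: "\<not> ?thesis"
    have "\<mu>\<^sup>2 \<le> 12 * \<nu> - 8 \<and> \<nu> \<ge> 1"
    proof (cases "(\<mu>, \<nu>) \<in> D1")
      case True
      then have "\<mu>\<^sup>2 \<le> 2\<^sup>2" by (intro abs_le_square_iff[THEN iffD1]) (auto simp: D1_def)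
      then show ?thesis using True by (simp add: D1_def)
    next
      case False
      then have \<mu>: "2 \<le> \<bar>\<mu>\<bar>" "\<nu> \<ge> (1/12) * (\<mu>\<^sup>2 + 8)" using D neg by (auto simp: D2_def D3_def)
      then have "2\<^sup>2 \<le> \<mu>\<^sup>2" by (metis abs_le_square_iff abs_numeral)
      with \<mu> show ?thesis by simp
    qed
    with False show False by blast
  qed
  then have m: "\<bar>\<mu>\<bar> \<ge> 4" and n: "\<nu> \<ge> (2/3) * (\<bar>\<mu>\<bar> - 1)" by auto
  \<comment> \<open>These are the coordinates of (|\<mu>|, \<nu>) = (4, 2) + t (1, 2/3) + r (0, 1).
    The corner (4, 2) lies on the parabola, so the previous lemma applies there.\<close>
  define t where "t = \<bar>\<mu>\<bar> - 4"
  define r where "r = \<nu> - (2/3) * (\<bar>\<mu>\<bar> - 1)"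
  have t: "t \<ge> 0" and r: "r \<ge> 0" using m n by (auto simp: t_def r_def)
  define \<sigma> where "\<sigma> = sgn \<mu>"
  have \<sigma>: "\<bar>\<sigma>\<bar> = 1" "\<sigma>\<^sup>2 = 1" and \<mu>: "\<mu> = 4 * \<sigma> + t * \<sigma>" and \<nu>: "\<nu> = 2 + t * (2/3) + r"
    using m by (auto simp: \<sigma>_def t_def r_def sgn_if field_simps)
  define x where "x = cmod c"
  have x: "0 \<le> x" "x \<le> 1" using c by (auto simp: x_def)
  have n2: "cmod c2 \<le> 1 - x\<^sup>2"
    unfolding c2 x_def[symmetric] norm_mult norm_of_real using x \<gamma>
    by (simp add: power_le_one mult_left_le)
  have A: "cmod (c3 + of_real (4 * \<sigma>) * c * c2 + of_real 2 * c ^ 3) \<le> 2"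
    by (rule prokhorov_szynal_parabola[OF c \<gamma> \<eta> _ _ c2 c3]) (simp_all add: power_mult_distrib \<sigma>)
  have "cmod (of_real \<sigma> * (c * c2) + of_real (2/3) * c ^ 3) \<le> x * cmod c2 + 2/3 * x ^ 3"
    by (rule order_trans[OF norm_triangle_ineq])
       (simp add: norm_mult norm_power norm_divide \<sigma> x_def)
  also have "\<dots> \<le> x * (1 - x\<^sup>2) + 2/3 * x ^ 3" using n2 x by (simp add: mult_left_mono)
  \<comment> \<open>The polynomial is x - x^3/3, which is stationary at x = 1 with value 2/3; hence
    the double factor \<open>(1 - x)\<^sup>2\<close>.\<close>
  also have "\<dots> = 2/3 - (1 - x)\<^sup>2 * (x + 2) / 3" by (simp add: power2_eq_square power3_eq_cube field_simps)
  also have "\<dots> \<le> 2/3" using x by simp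
  finally have B: "cmod (of_real \<sigma> * (c * c2) + of_real (2/3) * c ^ 3) \<le> 2/3" .
  have C: "cmod (c ^ 3) \<le> 1" using c by (simp add: norm_power power_le_one)
  have "c3 + of_real \<mu> * c * c2 + of_real \<nu> * c ^ 3
     = (c3 + of_real (4 * \<sigma>) * c * c2 + of_real 2 * c ^ 3)
       + of_real t * (of_real \<sigma> * (c * c2) + of_real (2/3) * c ^ 3) + of_real r * c ^ 3"
    unfolding \<mu> \<nu> of_real_add of_real_mult by (simp add: algebra_simps)
  also have "cmod \<dots> \<le> 2 + t * (2/3) + r * 1"
  proof (intro order_trans[OF norm_triangle_ineq add_mono] A)
    show "cmod (of_real t * (of_real \<sigma> * (c * c2) + of_real (2/3) * c ^ 3)) \<le> t * (2/3)"
      unfolding norm_mult norm_of_real using t B by (simp only: abs_of_nonneg mult_left_mono)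
    show "cmod (of_real r * c ^ 3) \<le> r * 1"
      unfolding norm_mult[of _ "c ^ 3"] norm_of_real using r C by (simp only: abs_of_nonneg mult_left_mono)
  qed
  finally show ?thesis using \<nu> by simp
qed

section \<open>Univalence and existence of starlike functions\<close>

text \<open>A local inverse of \<open>f\<close> pulls the segment from \<open>f z\<close> towards 0
  back to a curve \<open>h\<close> starting at \<open>z\<close> with velocity -f/f'. The squared
  modulus along it has initial derivative -2 |z|^2 Re (f/(z f')), which is negative because
  reciprocals preserve the sign of the real part. Stating the result for all small \<open>t\<close>
  lets two points be moved with the same \<open>t\<close>.\<close>

lemma shrink_along_ray:
  assumes hol: "f holomorphic_on unit_disc" and z: "z \<in> unit_disc" "z \<noteq> 0"
    and re: "Re (z * deriv f z / f z) > 0" and e: "\<epsilon> > 0"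
  shows "eventually (\<lambda>t. \<exists>z'. dist z' z < \<epsilon> \<and> cmod z' < cmod z \<and> f z' = of_real (1 - t) * f z) (at_right 0)"
proof -
  have nz: "f z \<noteq> 0" "deriv f z \<noteq> 0" using re by auto
  obtain r where r: "r > 0" "ball z r \<subseteq> unit_disc" "inj_on f (ball z r)"
    using has_complex_derivative_locally_injective[OF hol z(1) _ nz(2)] by auto
  have holr: "f holomorphic_on ball z r" using hol r(2) holomorphic_on_subset by blast
  obtain g where g: "g holomorphic_on f ` ball z r"
    "\<And>w. w \<in> ball z r \<Longrightarrow> deriv f w * deriv g (f w) = 1"
    "\<And>w. w \<in> ball z r \<Longrightarrow> g (f w) = w"
    using holomorphic_has_inverse[OF holr _ r(3)] by auto
  have op: "open (f ` ball z r)" using open_mapping_thm3[OF holr _ r(3)] by simp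
  have zr: "z \<in> ball z r" using r by simp
  define d where "d = - (f z / deriv f z)"
  define h where "h t = g (of_real (1 - t) * f z)" for t :: real
  have h0: "h 0 = z" using g(3)[OF zr] by (simp add: h_def)
  have "(g has_field_derivative inverse (deriv f z)) (at (f z))"
  proof -
    have "inverse (deriv f z) = deriv g (f z)" using g(2)[OF zr] by (simp add: inverse_unique)
    then show ?thesis using holomorphic_derivI[OF g(1) op] zr by auto
  qed
  moreover have "((\<lambda>t. of_real (1 - t) * f z) has_vector_derivative - f z) (at 0)"
    by (auto intro!: derivative_eq_intros simp: has_vector_derivative_def scaleR_conv_of_real)
  ultimately have dh: "(h has_vector_derivative d) (at 0)"
    using field_vector_diff_chain_at[of "\<lambda>t. of_real (1 - t) * f z" "- f z" 0 g "inverse (deriv f z)"]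
    by (simp add: h_def[abs_def] d_def o_def divide_inverse)
  have "((\<lambda>t. h t \<bullet> h t) has_derivative (\<lambda>t. h 0 \<bullet> (t *\<^sub>R d) + (t *\<^sub>R d) \<bullet> h 0)) (at 0)"
    using dh unfolding has_vector_derivative_def by (intro has_derivative_inner)
  then have "((\<lambda>t. h t \<bullet> h t) has_real_derivative 2 * (z \<bullet> d)) (at 0)"
    by (rule has_derivative_imp_has_field_derivative) (simp add: h0 inner_commute)
  moreover have "z \<bullet> d < 0"
  proof -
    have "Re (f z / (z * deriv f z)) > 0"
      using re by (metis inverse_divide inverse_complex.sel(1) sum_power2_gt_zero_iff order_less_irrefl divide_pos_pos)
    moreover have "z \<bullet> d = - (cmod z)\<^sup>2 * Re (f z / (z * deriv f z))"
    proof -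
      have "z \<bullet> d = Re (cnj z * d)" by (simp add: inner_complex_def)
      also have "cnj z * d = - (of_real ((cmod z)\<^sup>2) * (f z / (z * deriv f z)))"
        using z(2) by (simp add: d_def complex_norm_square field_simps flip: of_real_power)
      finally show ?thesis
        by (simp only: uminus_complex.sel times_complex.sel Re_complex_of_real Im_complex_of_real mult_zero_left diff_zero mult_minus_left)
    qed
    ultimately show ?thesis using z(2) by (simp add: mult_pos_pos)
  qed
  ultimately obtain \<delta> where \<delta>: "\<delta> > 0" "\<And>t. 0 < t \<Longrightarrow> t < \<delta> \<Longrightarrow> h t \<bullet> h t < z \<bullet> z"
    using has_real_derivative_neg_dec_right[of "\<lambda>t. h t \<bullet> h t" "2 * (z \<bullet> d)" 0 UNIV] h0 by auto
  have ev1: "eventually (\<lambda>t. cmod (h t) < cmod z) (at_right 0)"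
    unfolding eventually_at_right_field
    using \<delta> by (intro exI[of _ \<delta>]) (auto simp: norm_lt)
  \<comment> \<open>For small \<open>t\<close> the target stays in the open image of the ball on
    which \<open>g\<close> inverts \<open>f\<close>.\<close>
  have "(\<lambda>t. of_real (1 - t) * f z) \<midarrow>(0::real)\<rightarrow> of_real (1 - 0) * f z"
    by (intro tendsto_intros)
  then have "eventually (\<lambda>t::real. of_real (1 - t) * f z \<in> f ` ball z r) (at 0)"
    by (rule topological_tendstoD[OF _ op]) (use zr in auto)
  then have ev2: "eventually (\<lambda>t::real. of_real (1 - t) * f z \<in> f ` ball z r) (at_right 0)"
    by (rule filter_leD[OF at_le, rotated]) auto
  have "isCont h 0" using dh has_vector_derivative_continuous by blast
  then have "(h \<longlongrightarrow> z) (at 0)" using h0 by (simp add: isCont_def)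
  then have "eventually (\<lambda>t. dist (h t) z < \<epsilon>) (at 0)" using e by (rule tendstoD)
  then have ev3: "eventually (\<lambda>t. dist (h t) z < \<epsilon>) (at_right 0)"
    by (rule filter_leD[OF at_le, rotated]) auto
  show ?thesis
    using ev1 ev2 ev3
  proof eventually_elim
    case (elim t)
    then obtain w where w: "w \<in> ball z r" "of_real (1 - t) * f z = f w" by auto
    then have "f (h t) = of_real (1 - t) * f z" using g(3)[OF w(1)] by (simp add: h_def)
    then show ?case using elim by blast
  qed
qed

text \<open>The colliding pairs in a closed bidisc form a compact set \<open>P\<close>, so one of
  them minimises the larger modulus. Moving both of its points by the preceding lemma with a common
  \<open>t\<close> gives a colliding pair with a smaller maximum.\<close>

lemma starlike_imp_inj_on:
  assumes hol: "f holomorphic_on unit_disc" and f0: "f 0 = 0" "deriv f 0 \<noteq> 0"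
    and re: "\<And>z. z \<in> unit_disc \<Longrightarrow> z \<noteq> 0 \<Longrightarrow> Re (z * deriv f z / f z) > 0"
  shows "inj_on f unit_disc"
proof (rule inj_onI, rule ccontr)
  fix z1 z2 assume z12: "z1 \<in> unit_disc" "z2 \<in> unit_disc" "f z1 = f z2" "z1 \<noteq> z2"
  have fnz: "f z \<noteq> 0" if "z \<in> unit_disc" "z \<noteq> 0" for z using re[OF that] by auto
  have dnz: "deriv f z \<noteq> 0" if "z \<in> unit_disc" for z using re[OF that] f0 by (cases "z = 0") auto
  define \<rho> where "\<rho> = max (cmod z1) (cmod z2)"
  have \<rho>: "\<rho> < 1" using z12 by (auto simp: \<rho>_def)
  define K :: "(complex \<times> complex) set" where "K = cball 0 \<rho> \<times> cball 0 \<rho>"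
  define P where "P = {p \<in> K. f (fst p) = f (snd p) \<and> fst p \<noteq> snd p}"
  have sub: "cball 0 \<rho> \<subseteq> unit_disc" using \<rho> by auto
  have cont: "continuous_on (cball 0 \<rho>) f"
    using hol sub holomorphic_on_imp_continuous_on continuous_on_subset by blast
  have contK: "continuous_on K (\<lambda>p. f (fst p))" "continuous_on K (\<lambda>p. f (snd p))"
    unfolding K_def by (auto intro!: continuous_on_compose2[OF cont] continuous_intros)
  have "closed P"
    unfolding closed_sequential_limits
  proof safe
    fix s l assume s: "\<forall>n. s n \<in> P" and lim: "s \<longlonglongrightarrow> l"
    have clK: "closed K" by (simp add: K_def closed_Times)
    have sK: "s n \<in> K" for n using s by (auto simp: P_def)
    have l: "l \<in> K" using closed_sequentially[OF clK] sK lim by blast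
    have "closed {p \<in> K. f (fst p) = f (snd p)}"
      using continuous_closed_preimage_constant[OF continuous_on_diff[OF contK] clK, of 0] by simp
    then have eq: "f (fst l) = f (snd l)"
      using closed_sequentially[of "{p \<in> K. f (fst p) = f (snd p)}" s l] s lim by (auto simp: P_def)
    \<comment> \<open>Removing the diagonal does not destroy closedness: \<open>deriv f\<close> has
      no zero, so \<open>f\<close> is injective near each point and colliding pairs cannot converge
      to the diagonal.\<close>
    have "fst l \<noteq> snd l"
    proof
      assume d: "fst l = snd l"
      have "fst l \<in> unit_disc" using l sub by (auto simp: K_def)
      then obtain r where r: "r > 0" "inj_on f (ball (fst l) r)"
        using has_complex_derivative_locally_injective[OF hol _ open_ball dnz] by blast
      have "eventually (\<lambda>n. dist (fst (s n)) (fst l) < r \<and> dist (snd (s n)) (snd l) < r) sequentially"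
        using tendstoD[OF tendsto_fst[OF lim] r(1)] tendstoD[OF tendsto_snd[OF lim] r(1)]
        by (rule eventually_conj)
      then obtain n where "dist (fst (s n)) (fst l) < r" "dist (snd (s n)) (snd l) < r"
        using eventually_happens' sequentially_bot by blast
      then have "fst (s n) \<in> ball (fst l) r" "snd (s n) \<in> ball (fst l) r" using d by (auto simp: dist_commute)
      moreover have "f (fst (s n)) = f (snd (s n))" "fst (s n) \<noteq> snd (s n)" using s by (auto simp: P_def)
      ultimately show False using r(2) by (auto dest: inj_onD)
    qed
    with l eq show "l \<in> P" by (auto simp: P_def)
  qed
  moreover have "bounded P"
    by (rule bounded_subset[of K]) (auto simp: P_def K_def bounded_Times)
  ultimately have "compact P" using compact_eq_bounded_closed by blast
  moreover have "P \<noteq> {}" using z12 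
  proof -
    have "(z1, z2) \<in> P" using z12 by (auto simp: P_def K_def \<rho>_def)
    then show ?thesis by blast
  qed
  moreover have "continuous_on P (\<lambda>p. max (cmod (fst p)) (cmod (snd p)))"
    by (intro continuous_intros)
  ultimately have "\<exists>p\<in>P. \<forall>q\<in>P. max (cmod (fst p)) (cmod (snd p)) \<le> max (cmod (fst q)) (cmod (snd q))"
    by (rule continuous_attains_inf)
  then obtain p where p: "p \<in> P"
    "\<And>q. q \<in> P \<Longrightarrow> max (cmod (fst p)) (cmod (snd p)) \<le> max (cmod (fst q)) (cmod (snd q))"
    by blast
  define z w where "z = fst p" and "w = snd p"
  have zw: "cmod z \<le> \<rho>" "cmod w \<le> \<rho>" "f z = f w" "z \<noteq> w"
    using p(1) by (auto simp: P_def K_def z_def w_def)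
  have disc: "z \<in> unit_disc" "w \<in> unit_disc" using zw \<rho> by auto
  \<comment> \<open>\<open>f\<close> vanishes only at the origin, so if one point of the pair were
    0, both would be.\<close>
  have nz: "z \<noteq> 0" "w \<noteq> 0" using zw fnz[OF disc(1)] fnz[OF disc(2)] f0 by auto
  \<comment> \<open>Moving each point by less than half their distance keeps the two points
    distinct.\<close>
  have e: "dist z w / 2 > 0" using zw by simp
  have "eventually (\<lambda>t. (\<exists>z'. dist z' z < dist z w / 2 \<and> cmod z' < cmod z \<and> f z' = of_real (1 - t) * f z)
      \<and> (\<exists>w'. dist w' w < dist z w / 2 \<and> cmod w' < cmod w \<and> f w' = of_real (1 - t) * f w)) (at_right 0)"
    by (intro eventually_conj shrink_along_ray hol disc nz re e)
  then obtain t where "(\<exists>z'. dist z' z < dist z w / 2 \<and> cmod z' < cmod z \<and> f z' = of_real (1 - t) * f z)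
      \<and> (\<exists>w'. dist w' w < dist z w / 2 \<and> cmod w' < cmod w \<and> f w' = of_real (1 - t) * f w)"
    using eventually_happens'[OF trivial_limit_at_right_real] by blast
  then obtain z' w' where z': "dist z' z < dist z w / 2" "cmod z' < cmod z" "f z' = of_real (1 - t) * f z"
    and w': "dist w' w < dist z w / 2" "cmod w' < cmod w" "f w' = of_real (1 - t) * f w"
    by blast
  have "z' \<noteq> w'"
  proof
    assume "z' = w'"
    have "dist z w < dist z w"
      using z'(1) w'(1) \<open>z' = w'\<close> dist_triangle_half_l[of z z' "dist z w" w] by (simp add: dist_commute)
    then show False by simp
  qed
  then have "(z', w') \<in> P" using z' w' zw by (auto simp: P_def K_def)
  from p(2)[OF this] z' w' show False by (auto simp: z_def w_def)
qed

text \<open>The equation z f'/f = \<psi> is solved by z times the exponential of a primitive of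
  (\<psi> - 1)/z, which is holomorphic since \<open>\<psi> 0 = 1\<close>. Positivity of the real
  part then yields univalence.\<close>

lemma starlike_exists:
  assumes hol: "\<psi> holomorphic_on unit_disc" and \<psi>0: "\<psi> 0 = 1"
    and re: "\<And>z. z \<in> unit_disc \<Longrightarrow> Re (\<psi> z) > 0"
  obtains f where "f \<in> class_S" "\<And>z. z \<in> unit_disc \<Longrightarrow> starlike_quotient f z = \<psi> z"
proof -
  have "(\<lambda>z. \<psi> z - 1) holomorphic_on unit_disc" "\<psi> 0 - 1 = 0" using hol \<psi>0 by (auto intro: holomorphic_intros)
  then obtain q where q: "q holomorphic_on unit_disc" "\<And>z. cmod z < 1 \<Longrightarrow> \<psi> z - 1 = z * q z"
    using Schwarz3[of "\<lambda>z. \<psi> z - 1" 1] by metis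
  obtain Q where "\<And>z. z \<in> unit_disc \<Longrightarrow> (Q has_field_derivative q z) (at z within unit_disc)"
    using holomorphic_convex_primitive'[OF _ _ q(1)] by auto
  then have Q: "(Q has_field_derivative q z) (at z)" if "z \<in> unit_disc" for z
    using that by (metis at_within_open open_ball)
  \<comment> \<open>Subtracting \<open>Q 0\<close> normalises the derivative at 0 to 1.\<close>
  define f where "f z = z * exp (Q z - Q 0)" for z
  have df: "(f has_field_derivative exp (Q z - Q 0) * \<psi> z) (at z)" if z: "z \<in> unit_disc" for z
  proof -
    have "\<psi> z = 1 + z * q z" using q(2)[of z] z by (simp add: algebra_simps)
    then show ?thesis unfolding f_def
      by (auto intro!: derivative_eq_intros Q[OF z] simp: algebra_simps)
  qed
  have fhol: "f holomorphic_on unit_disc" using df by (meson holomorphic_on_open open_ball)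
  have sq: "starlike_quotient f z = \<psi> z" if z: "z \<in> unit_disc" for z
    using DERIV_imp_deriv[OF df[OF z]] \<psi>0 by (auto simp: starlike_quotient_def f_def)
  have d0: "deriv f 0 = 1" using DERIV_imp_deriv[OF df[of 0]] \<psi>0 by simp
  have "inj_on f unit_disc"
  proof (rule starlike_imp_inj_on[OF fhol])
    fix z assume "z \<in> unit_disc" "z \<noteq> 0"
    then show "Re (z * deriv f z / f z) > 0" using sq[of z] re[of z] by (simp add: starlike_quotient_def)
  qed (auto simp: d0, simp add: f_def)
  then have "f \<in> class_S" using fhol d0 by (simp add: class_S_def fps_expansion_def f_def)
  with sq that show ?thesis by blast
qed

section \<open>The determinant in terms of the Schwarz coefficients\<close>

lemma T32_factorization:
  "T32 f = (taylor_coeff f 2 - taylor_coeff f 4)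
         * ((taylor_coeff f 2)\<^sup>2 + taylor_coeff f 2 * taylor_coeff f 4 - 2 * (taylor_coeff f 3)\<^sup>2)"
  by (simp add: T32_def toeplitz_matrix_3_2_def det_3 power2_eq_square algebra_simps)

text \<open>Coefficients are compared in z f' = f (\<phi> o \<omega>). Since
  \<open>\<phi> 0 = 1\<close>, the n-th equation has a_n on both sides and determines (n - 1) a_n
  from earlier coefficients; the factors 2 and 6 keep the formulas free of denominators.\<close>

lemma subordinate_starlike_coeffs:
  fixes f \<phi> \<omega> :: "complex \<Rightarrow> complex"
  defines "a \<equiv> taylor_coeff f" and "b \<equiv> taylor_coeff \<phi>" and "c \<equiv> taylor_coeff \<omega>"
  assumes f: "f \<in> class_S" and \<phi>: "\<phi> holomorphic_on unit_disc" "\<phi> 0 = 1"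
    and \<omega>: "schwarz_function \<omega>"
    and sq: "\<And>z. z \<in> unit_disc \<Longrightarrow> starlike_quotient f z = \<phi> (\<omega> z)"
  shows "a 2 = b 1 * c 1"
    and "2 * a 3 = b 1 * c 2 + (b 2 + (b 1)\<^sup>2) * (c 1)\<^sup>2"
    and "6 * a 4 = 2 * b 1 * c 3 + (4 * b 2 + 3 * (b 1)\<^sup>2) * c 1 * c 2
                     + (2 * b 3 + 3 * b 1 * b 2 + b 1 ^ 3) * c 1 ^ 3"
proof -
  define F P W where "F = fps_expansion f 0" and "P = fps_expansion \<phi> 0" and "W = fps_expansion \<omega> 0"
  have hol: "f holomorphic_on unit_disc" "\<omega> holomorphic_on unit_disc" and inj: "inj_on f unit_disc"
    and \<omega>0: "\<omega> 0 = 0" and f01: "fps_nth F 0 = 0" "fps_nth F (Suc 0) = 1"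
    using f \<omega> by (auto simp: class_S_def schwarz_function_def F_def)
  have W0: "fps_nth W 0 = 0" and P0: "fps_nth P 0 = 1"
    by (simp_all add: W_def P_def taylor_coeff_0 \<omega>0 \<phi>)
  have "f 0 = 0" using f01 by (simp add: F_def taylor_coeff_0)
  then have fnz: "f z \<noteq> 0" if "z \<in> unit_disc" "z \<noteq> 0" for z
    using that inj by (metis centre_in_ball inj_onD zero_less_one)
  have "fps_X * fps_deriv F = F * (P oo W)"
  proof (rule has_fps_expansion_unit_disc_cong)
    show "(\<lambda>z. z * deriv f z) has_fps_expansion fps_X * fps_deriv F"
      unfolding F_def by (intro fps_expansion_intros has_fps_expansion_unit_disc hol)
    show "(\<lambda>z. f z * (\<phi> \<circ> \<omega>) z) has_fps_expansion F * (P oo W)"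
      using W0 unfolding F_def P_def W_def
      by (intro fps_expansion_intros has_fps_expansion_unit_disc hol \<phi>(1))
    \<comment> \<open>At the origin both sides vanish because \<open>f 0 = 0\<close>; elsewhere
      injectivity makes \<open>f\<close> nonzero, so the quotient can be cleared.\<close>
    show "z * deriv f z = f z * (\<phi> \<circ> \<omega>) z" if "z \<in> unit_disc" for z
      using sq[OF that] fnz[OF that] \<open>f 0 = 0\<close>
      by (cases "z = 0") (auto simp: starlike_quotient_def field_simps)
  qed
  then have rec: "fps_nth (fps_X * fps_deriv F) n = (\<Sum>i=0..n. fps_nth F i * fps_nth (P oo W) (n - i))" for n
    by (simp add: fps_mult_nth)
  note fps_simps = fps_compose_nth fps_mult_nth numeral_eq_Suc power2_eq_square W0 P0 f01
  have PW: "fps_nth (P oo W) 1 = b 1 * c 1"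
    "fps_nth (P oo W) 2 = b 1 * c 2 + b 2 * (c 1)\<^sup>2"
    "fps_nth (P oo W) 3 = b 1 * c 3 + 2 * b 2 * c 1 * c 2 + b 3 * c 1 ^ 3"
    unfolding b_def c_def P_def[symmetric] W_def[symmetric]
    by (simp_all add: fps_simps algebra_simps)
  note PW' = PW[unfolded numeral_eq_Suc One_nat_def, simplified]
  have a2: "2 * a 2 = a 2 + b 1 * c 1"
    using rec[of 2] P0 PW' unfolding a_def F_def[symmetric]
    by (simp add: numeral_eq_Suc f01 algebra_simps)
  then show A2: "a 2 = b 1 * c 1" by simp
  have a3: "3 * a 3 = a 3 + a 2 * (b 1 * c 1) + (b 1 * c 2 + b 2 * (c 1)\<^sup>2)"
    using rec[of 3] P0 PW' unfolding a_def F_def[symmetric]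
    by (simp add: numeral_eq_Suc f01 algebra_simps)
  then show A3: "2 * a 3 = b 1 * c 2 + (b 2 + (b 1)\<^sup>2) * (c 1)\<^sup>2"
    unfolding A2 by (simp add: power2_eq_square algebra_simps)
  have a4: "4 * a 4 = a 4 + a 3 * (b 1 * c 1) + a 2 * (b 1 * c 2 + b 2 * (c 1)\<^sup>2)
      + (b 1 * c 3 + 2 * b 2 * c 1 * c 2 + b 3 * c 1 ^ 3)"
    using rec[of 4] P0 PW' unfolding a_def F_def[symmetric]
    by (simp add: numeral_eq_Suc f01 algebra_simps)
  show "6 * a 4 = 2 * b 1 * c 3 + (4 * b 2 + 3 * (b 1)\<^sup>2) * c 1 * c 2
                     + (2 * b 3 + 3 * b 1 * b 2 + b 1 ^ 3) * c 1 ^ 3"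
    using a4 A3 A2 by algebra
qed

text \<open>\<open>q1\<close> and \<open>q2\<close> are what remains of the fourth coefficient after
  extracting B1/3. \<open>M\<close> and \<open>K\<close> collect the coefficients of c1^2 c2 and
  c1^4 in the second factor; in these terms the two numerical hypotheses of the theorem read 6 B1^2
  \<le> M \<le> B1^2 + 6 K.\<close>

lemma T32_subordinate_starlike:
  fixes f \<phi> \<omega> :: "complex \<Rightarrow> complex" and B :: "nat \<Rightarrow> real"
  defines "c \<equiv> taylor_coeff \<omega>"
  defines "q1 \<equiv> (3 * B 1^2 + 4 * B 2) / (2 * B 1)"
    and "q2 \<equiv> (B 1^3 + 3 * B 1 * B 2 + 2 * B 3) / (2 * B 1)"
    and "M \<equiv> B 1 * (3 * B 1^2 + 2 * B 2)"
    and "K \<equiv> B 1^4 / 3 + B 1^2 * B 2 / 2 + B 2^2 / 2 - B 1 * B 3 / 3"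
  assumes B: "\<And>n. taylor_coeff \<phi> n = of_real (B n)" and B1: "B 1 \<noteq> 0"
    and f: "f \<in> class_S" and \<phi>: "\<phi> holomorphic_on unit_disc" "\<phi> 0 = 1"
    and \<omega>: "schwarz_function \<omega>"
    and sq: "\<And>z. z \<in> unit_disc \<Longrightarrow> starlike_quotient f z = \<phi> (\<omega> z)"
  shows "T32 f = of_real (B 1) * (c 1 - (c 3 + of_real q1 * c 1 * c 2 + of_real q2 * c 1 ^ 3) / 3)
    * (of_real ((B 1)\<^sup>2) * (c 1)\<^sup>2 + of_real ((B 1)\<^sup>2 / 3) * c 1 * c 3 - of_real (M / 6) * (c 1)\<^sup>2 * c 2
       - of_real K * c 1 ^ 4 - of_real ((B 1)\<^sup>2 / 2) * (c 2)\<^sup>2)"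
proof -
  define a :: "nat \<Rightarrow> complex" where "a = taylor_coeff f"
  define E where "E = c 3 + of_real q1 * c 1 * c 2 + of_real q2 * c 1 ^ 3"
  define S where "S = of_real ((B 1)\<^sup>2) * (c 1)\<^sup>2 + of_real ((B 1)\<^sup>2 / 3) * c 1 * c 3
    - of_real (M / 6) * (c 1)\<^sup>2 * c 2 - of_real K * c 1 ^ 4 - of_real ((B 1)\<^sup>2 / 2) * (c 2)\<^sup>2"
  define \<beta>1 \<beta>2 \<beta>3 where "\<beta>1 = complex_of_real (B 1)" and "\<beta>2 = complex_of_real (B 2)"
    and "\<beta>3 = complex_of_real (B 3)"
  have coeffs: "a 2 = \<beta>1 * c 1" "2 * a 3 = \<beta>1 * c 2 + (\<beta>2 + \<beta>1\<^sup>2) * (c 1)\<^sup>2"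
    "6 * a 4 = 2 * \<beta>1 * c 3 + (4 * \<beta>2 + 3 * \<beta>1\<^sup>2) * c 1 * c 2
       + (2 * \<beta>3 + 3 * \<beta>1 * \<beta>2 + \<beta>1 ^ 3) * c 1 ^ 3"
    unfolding a_def c_def \<beta>1_def \<beta>2_def \<beta>3_def B[symmetric]
    by (rule subordinate_starlike_coeffs[OF f \<phi> \<omega>], erule sq)+
  have E: "6 * a 4 = 2 * \<beta>1 * E"
  proof -
    have "2 * B 1 * q1 = 3 * B 1^2 + 4 * B 2" "2 * B 1 * q2 = B 1^3 + 3 * B 1 * B 2 + 2 * B 3"
      using B1 by (simp_all add: q1_def q2_def)
    from this[THEN arg_cong[of _ _ complex_of_real]]
    have "2 * \<beta>1 * of_real q1 = 3 * \<beta>1\<^sup>2 + 4 * \<beta>2" "2 * \<beta>1 * of_real q2 = \<beta>1 ^ 3 + 3 * \<beta>1 * \<beta>2 + 2 * \<beta>3"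
      by (simp_all only: of_real_mult of_real_add of_real_power of_real_numeral \<beta>1_def \<beta>2_def \<beta>3_def)
    moreover have "2 * \<beta>1 * E = 2 * \<beta>1 * c 3 + (2 * \<beta>1 * of_real q1) * c 1 * c 2
        + (2 * \<beta>1 * of_real q2) * c 1 ^ 3"
      unfolding E_def by (simp only: algebra_simps)
    ultimately show ?thesis using coeffs(3) by (simp only: algebra_simps)
  qed
  \<comment> \<open>The factor 6 clears all denominators and matches the available formulas for
    \<open>2 * a 3\<close> and \<open>6 * a 4\<close>.\<close>
  have "6 * S = 6 * \<beta>1\<^sup>2 * (c 1)\<^sup>2 + 2 * \<beta>1\<^sup>2 * c 1 * c 3 - \<beta>1 * (3 * \<beta>1\<^sup>2 + 2 * \<beta>2) * (c 1)\<^sup>2 * c 2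
      - (2 * \<beta>1 ^ 4 + 3 * \<beta>1\<^sup>2 * \<beta>2 + 3 * \<beta>2\<^sup>2 - 2 * \<beta>1 * \<beta>3) * c 1 ^ 4 - 3 * \<beta>1\<^sup>2 * (c 2)\<^sup>2"
    unfolding S_def M_def K_def \<beta>1_def \<beta>2_def \<beta>3_def by (simp add: field_simps)
  also have "\<dots> = 6 * (a 2)\<^sup>2 + a 2 * (6 * a 4) - 3 * (2 * a 3)\<^sup>2"
    unfolding coeffs by algebra
  also have "\<dots> = 6 * ((a 2)\<^sup>2 + a 2 * a 4 - 2 * (a 3)\<^sup>2)"
    by (simp add: power_mult_distrib algebra_simps)
  finally have "S = (a 2)\<^sup>2 + a 2 * a 4 - 2 * (a 3)\<^sup>2" by (subst (asm) mult_cancel_left) simp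
  moreover have "\<beta>1 * (c 1 - E / 3) = a 2 - a 4" using E coeffs(1) by (simp add: field_simps)
  ultimately show ?thesis
    unfolding T32_factorization a_def[symmetric] E_def[symmetric] S_def[symmetric] \<beta>1_def[symmetric] by simp
qed

section \<open>Estimate of the second factor\<close>

text \<open>After the triangle inequality everything depends on x = |c|. The gap to
  \<open>b\<^sup>2 + K\<close> is \<open>v = 1 - x\<^sup>2\<close> times a sum of nonnegative terms,
  where \<open>M \<le> b\<^sup>2 + 6 * K\<close> controls the mixed term; the gap closes at |c| =
  1.\<close>

lemma second_factor_bound:
  fixes b M K :: real and c c2 c3 :: complex
  assumes c: "cmod c \<le> 1" "cmod c2 \<le> 1 - (cmod c)\<^sup>2" "cmod c3 \<le> 1 - (cmod c)\<^sup>2"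
    and M: "0 \<le> M" "M \<le> b\<^sup>2 + 6 * K" and K: "0 \<le> K"
  shows "cmod (of_real (b\<^sup>2) * c\<^sup>2 + of_real (b\<^sup>2 / 3) * c * c3 - of_real (M / 6) * c\<^sup>2 * c2
       - of_real K * c ^ 4 - of_real (b\<^sup>2 / 2) * c2\<^sup>2) \<le> b\<^sup>2 + K"
proof -
  define x v where "x = cmod c" and "v = 1 - x\<^sup>2"
  have x: "0 \<le> x" "x \<le> 1" and v: "0 \<le> v" "v \<le> 1" "x\<^sup>2 = 1 - v"
    using c(1) by (auto simp: x_def v_def power_le_one)
  have c23: "cmod c2 \<le> v" "cmod c3 \<le> v" using c by (auto simp: v_def x_def)
  have tri: "cmod (p + q - r - s - t) \<le> cmod p + cmod q + cmod r + cmod s + cmod t" for p q r s t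
    by (meson add_mono norm_triangle_ineq norm_triangle_ineq4 order_refl order_trans)
  have "cmod (of_real (b\<^sup>2) * c\<^sup>2 + of_real (b\<^sup>2 / 3) * c * c3 - of_real (M / 6) * c\<^sup>2 * c2
       - of_real K * c ^ 4 - of_real (b\<^sup>2 / 2) * c2\<^sup>2)
    \<le> b\<^sup>2 * x\<^sup>2 + b\<^sup>2 / 3 * x * cmod c3 + M / 6 * x\<^sup>2 * cmod c2 + K * x ^ 4 + b\<^sup>2 / 2 * (cmod c2)\<^sup>2"
    by (rule order_trans[OF tri]) (use M K in \<open>simp only: norm_mult norm_power norm_of_real x_def abs_of_nonneg
        divide_nonneg_nonneg zero_le_power2 zero_le_numeral order_refl\<close>)
  also have "\<dots> \<le> b\<^sup>2 * x\<^sup>2 + b\<^sup>2 / 3 * x * v + M / 6 * x\<^sup>2 * v + K * x ^ 4 + b\<^sup>2 / 2 * v\<^sup>2"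
    using c23 x M K by (intro add_mono mult_left_mono power_mono) auto
  also have "x ^ 4 = (1 - v)\<^sup>2" 
    using power_mult[of x 2 2] v(3) by simp
  also have "b\<^sup>2 * x\<^sup>2 + b\<^sup>2 / 3 * x * v + M / 6 * x\<^sup>2 * v + K * (1 - v)\<^sup>2 + b\<^sup>2 / 2 * v\<^sup>2
    = b\<^sup>2 + K - v * (b\<^sup>2 * ((1 - x) / 3 + 1 / 6 + x\<^sup>2 / 3) + K + x\<^sup>2 * (b\<^sup>2 + 6 * K - M) / 6)"
    unfolding v(3) by (simp add: field_simps power2_eq_square)
  also have "\<dots> \<le> b\<^sup>2 + K"
    using x v M K by (auto intro!: mult_nonneg_nonneg add_nonneg_nonneg)
  finally show ?thesis .
qed

text \<open>The inner bracket of the third coefficient is bounded by a convex combination with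
  weights 1 - |\<gamma>|^2 and |\<gamma>|^2.\<close>

lemma schwarz_coeffs_norm_le:
  assumes "cmod c \<le> 1" "cmod \<gamma> \<le> 1" "cmod \<eta> \<le> 1"
  shows "cmod (of_real (1 - (cmod c)\<^sup>2) * \<gamma>) \<le> 1 - (cmod c)\<^sup>2"
    and "cmod (of_real (1 - (cmod c)\<^sup>2) * (of_real (1 - (cmod \<gamma>)\<^sup>2) * \<eta> - cnj c * \<gamma>\<^sup>2)) \<le> 1 - (cmod c)\<^sup>2"
proof -
  have v: "0 \<le> 1 - (cmod c)\<^sup>2" "0 \<le> 1 - (cmod \<gamma>)\<^sup>2" using assms by (auto simp: power_le_one)
  have le: "cmod (of_real (1 - (cmod c)\<^sup>2) * w) \<le> 1 - (cmod c)\<^sup>2" if "cmod w \<le> 1" for w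
    unfolding norm_mult norm_of_real using mult_left_mono[OF that v(1)] v(1) by simp
  show "cmod (of_real (1 - (cmod c)\<^sup>2) * \<gamma>) \<le> 1 - (cmod c)\<^sup>2" using le assms by blast
  have "cmod (of_real (1 - (cmod \<gamma>)\<^sup>2) * \<eta> - cnj c * \<gamma>\<^sup>2)
      \<le> (1 - (cmod \<gamma>)\<^sup>2) * cmod \<eta> + cmod c * (cmod \<gamma>)\<^sup>2"
    by (rule order_trans[OF norm_triangle_ineq4]) (use v in \<open>simp only: norm_mult norm_power norm_of_real
        complex_mod_cnj abs_of_nonneg order_refl\<close>)
  also have "\<dots> \<le> (1 - (cmod \<gamma>)\<^sup>2) * 1 + 1 * (cmod \<gamma>)\<^sup>2"
    using v assms by (intro add_mono mult_left_mono mult_right_mono) auto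
  finally show "cmod (of_real (1 - (cmod c)\<^sup>2) * (of_real (1 - (cmod \<gamma>)\<^sup>2) * \<eta> - cnj c * \<gamma>\<^sup>2)) \<le> 1 - (cmod c)\<^sup>2"
    using le by simp
qed

section \<open>The sharp bound from the two factor estimates\<close>

theorem theorem3p1:
  fixes \<phi> :: "complex \<Rightarrow> complex" and B :: "nat \<Rightarrow> real" and q1 q2 :: real
  assumes "ma_minda \<phi>"
    and "\<And>n. B n = Re (taylor_coeff \<phi> n)"
    and "6 * B 1^2 \<le> B 1 * (3 * B 1^2 + 2 * B 2)"
    and "B 1 * (3 * B 1^2 + 2 * B 2)
           \<le> B 1^2 + 2 * B 1^4 + 3 * B 1^2 * B 2 + 3 * B 2^2 - 2 * B 1 * B 3"
    and "q1 = (3 * B 1^2 + 4 * B 2) / (2 * B 1)"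
    and "q2 = (B 1^3 + 3 * B 1 * B 2 + 2 * B 3) / (2 * B 1)"
    and "(q1, q2) \<in> D1 \<union> D2 \<union> D3"
  defines "bound \<equiv> (B 1 + (B 1^3 + 3 * B 1 * B 2 + 2 * B 3) / 6) *
                   (B 1^2 + B 1^4 / 3 + B 1^2 * B 2 / 2 + B 2^2 / 2 - B 1 * B 3 / 3)"
  shows "(\<forall>f\<in>S_star \<phi>. cmod (T32 f) \<le> bound) \<and> (\<exists>f\<in>S_star \<phi>. cmod (T32 f) = bound)"
proof -
  define M K where "M = B 1 * (3 * B 1^2 + 2 * B 2)"
    and "K = B 1^4 / 3 + B 1^2 * B 2 / 2 + B 2^2 / 2 - B 1 * B 3 / 3"
  have \<phi>: "\<phi> holomorphic_on unit_disc" "\<phi> 0 = 1" and re\<phi>: "\<And>z. z \<in> unit_disc \<Longrightarrow> Re (\<phi> z) > 0"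
    and dpos: "Re (deriv \<phi> 0) > 0"
    using assms(1) by (auto simp: ma_minda_def)
  have B: "taylor_coeff \<phi> n = of_real (B n)" for n
    using ma_minda_coeff_real[OF assms(1)] assms(2) by simp
  have B1: "B 1 > 0" using dpos assms(2)[of 1] by (simp add: fps_expansion_def)
  \<comment> \<open>From 6 B1^2 \<le> M \<le> B1^2 + 6 K one gets 6 K \<ge> 5 B1^2, so both
    constants are nonnegative.\<close>
  have M: "0 \<le> M" "M \<le> (B 1)\<^sup>2 + 6 * K" and K: "0 \<le> K"
  proof -
    have "6 * (B 1)\<^sup>2 \<le> M" using assms(3) by (simp add: M_def)
    moreover have "6 * K = 2 * B 1^4 + 3 * B 1^2 * B 2 + 3 * B 2^2 - 2 * B 1 * B 3"
      by (simp add: K_def field_simps)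
    then show "M \<le> (B 1)\<^sup>2 + 6 * K" using assms(4) unfolding M_def by linarith
    moreover have "0 \<le> (B 1)\<^sup>2" by simp
    ultimately show "0 \<le> M" "0 \<le> K" by linarith+
  qed
  \<comment> \<open>Each of the three regions lies in the upper half-plane.\<close>
  have q2: "q2 \<ge> 0"
    using assms(7) by (auto simp: D1_def D2_def D3_def) (smt (verit) zero_le_power2)
  have bound: "bound = B 1 * (1 + q2 / 3) * ((B 1)\<^sup>2 + K)"
    using B1 unfolding bound_def assms(6) K_def by (simp add: field_simps)
  define S where "S c c2 c3 = of_real ((B 1)\<^sup>2) * c\<^sup>2 + of_real ((B 1)\<^sup>2 / 3) * c * c3
    - of_real (M / 6) * c\<^sup>2 * c2 - of_real K * c ^ 4 - of_real ((B 1)\<^sup>2 / 2) * c2\<^sup>2" for c c2 c3 :: complex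
  define E where "E c c2 c3 = c3 + of_real q1 * c * c2 + of_real q2 * c ^ 3" for c c2 c3 :: complex
  have T32: "T32 f = of_real (B 1) * (taylor_coeff \<omega> 1 - E (taylor_coeff \<omega> 1) (taylor_coeff \<omega> 2) (taylor_coeff \<omega> 3) / 3)
      * S (taylor_coeff \<omega> 1) (taylor_coeff \<omega> 2) (taylor_coeff \<omega> 3)"
    if "f \<in> class_S" "schwarz_function \<omega>" "\<And>z. z \<in> unit_disc \<Longrightarrow> starlike_quotient f z = \<phi> (\<omega> z)" for f \<omega>
    using T32_subordinate_starlike[OF B _ that(1) \<phi> that(2,3)] B1
    unfolding S_def E_def M_def K_def assms(5,6) by simp
  have "cmod (T32 f) \<le> bound" if f: "f \<in> S_star \<phi>" for f
  proof -
    obtain \<omega> where \<omega>: "schwarz_function \<omega>" "\<And>z. z \<in> unit_disc \<Longrightarrow> starlike_quotient f z = \<phi> (\<omega> z)"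
      using f by (auto simp: S_star_def subordinate_def)
    obtain c \<gamma> \<eta> where c: "cmod c \<le> 1" "cmod \<gamma> \<le> 1" "cmod \<eta> \<le> 1" "taylor_coeff \<omega> 1 = c"
      and c2: "taylor_coeff \<omega> 2 = of_real (1 - (cmod c)\<^sup>2) * \<gamma>"
      and c3: "taylor_coeff \<omega> 3 = of_real (1 - (cmod c)\<^sup>2) * (of_real (1 - (cmod \<gamma>)\<^sup>2) * \<eta> - cnj c * \<gamma>\<^sup>2)"
      using schwarz_coeffs[OF \<omega>(1)] by metis
    define c2 c3 where "c2 = taylor_coeff \<omega> 2" and "c3 = taylor_coeff \<omega> 3"
    note c2 = c2[folded c2_def] and c3 = c3[folded c3_def]
    have T: "T32 f = of_real (B 1) * (c - E c c2 c3 / 3) * S c c2 c3"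
      using T32[OF _ \<omega>] f unfolding c(4) c2_def[symmetric] c3_def[symmetric] by (simp add: S_star_def)
    have "cmod (E c c2 c3) \<le> q2"
      unfolding E_def by (rule prokhorov_szynal[OF c(1-3) assms(7) c2 c3])
    then have "cmod (c - E c c2 c3 / 3) \<le> 1 + q2 / 3"
      using c(1) norm_triangle_ineq4[of c "E c c2 c3 / 3"] by (simp add: norm_divide)
    moreover have "cmod (S c c2 c3) \<le> (B 1)\<^sup>2 + K"
      unfolding S_def using schwarz_coeffs_norm_le[OF c(1-3)]
      by (intro second_factor_bound c M K) (auto simp: c2 c3)
    ultimately show ?thesis
      unfolding T bound norm_mult norm_of_real using B1 q2 by (intro mult_mono) auto
  qed
  moreover have "\<exists>f\<in>S_star \<phi>. cmod (T32 f) = bound"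
  proof -
    \<comment> \<open>Here c1 = i and c2 = c3 = 0. As i^3 = -i, the terms of c1 - q2 c1^3/3 point
      the same way; as i^2 = -1 and i^4 = 1, so do those of B1^2 c1^2 - K c1^4. Both triangle
      inequalities are therefore equalities.\<close>
    define \<omega> :: "complex \<Rightarrow> complex" where "\<omega> z = \<i> * z" for z
    have \<omega>: "schwarz_function \<omega>"
      by (auto simp: schwarz_function_def \<omega>_def[abs_def] norm_mult intro!: holomorphic_intros)
    have \<phi>\<omega>: "(\<lambda>z. \<phi> (\<omega> z)) holomorphic_on unit_disc"
      using holomorphic_on_compose_gen[of \<omega> unit_disc \<phi> unit_disc] \<omega> \<phi> by (simp add: schwarz_function_def o_def)
    obtain f where f: "f \<in> class_S" "\<And>z. z \<in> unit_disc \<Longrightarrow> starlike_quotient f z = \<phi> (\<omega> z)"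
    proof (rule starlike_exists[OF \<phi>\<omega>])
      show "\<phi> (\<omega> 0) = 1" using \<phi> by (simp add: \<omega>_def)
      show "Re (\<phi> (\<omega> z)) > 0" if "z \<in> unit_disc" for z
        using re\<phi>[of "\<omega> z"] that by (simp add: \<omega>_def norm_mult)
    qed blast
    \<comment> \<open>Holomorphy, including at the removable singularity, is inherited from \<phi> o
      \<omega>, with which the quotient agrees on the disc.\<close>
    have "starlike_quotient f holomorphic_on unit_disc"
      using holomorphic_transform[OF \<phi>\<omega>] f(2) by metis
    then have fS: "f \<in> S_star \<phi>" using f \<omega> \<phi>(1) by (auto simp: S_star_def subordinate_def)
    have "\<omega> has_fps_expansion fps_const \<i> * fps_X"
      unfolding \<omega>_def by (intro fps_expansion_intros)
    then have "fps_expansion \<omega> 0 = fps_const \<i> * fps_X" by (rule fps_expansion_eqI)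
    then have "taylor_coeff \<omega> 1 = \<i>" "taylor_coeff \<omega> 2 = 0" "taylor_coeff \<omega> 3 = 0" by simp_all
    then have T: "T32 f = of_real (B 1) * (\<i> - E \<i> 0 0 / 3) * S \<i> 0 0"
      using T32[OF f(1) \<omega> f(2)] by simp
    have E: "\<i> - E \<i> 0 0 / 3 = \<i> * of_real (1 + q2 / 3)"
      by (simp add: E_def power3_eq_cube algebra_simps)
    have S: "S \<i> 0 0 = of_real (- ((B 1)\<^sup>2 + K))" by (simp add: S_def)
    have "0 \<le> 1 + q2 / 3" "0 \<le> (B 1)\<^sup>2 + K" using q2 K by simp_all
    then have "cmod (T32 f) = B 1 * (1 + q2 / 3) * ((B 1)\<^sup>2 + K)"
      unfolding T E S norm_mult norm_of_real norm_ii abs_minus_cancel using B1 by simp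
    then show ?thesis using fS bound by auto
  qed
  ultimately show ?thesis by blast
qed

end
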